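(* Let $(\mathcal{T},\mathcal{F})$ be a pretorsion theory in an additive category $\mathcal{C}$ with class of trivial objects $\mathcal{Z}$. The quotient functor $\Sigma\colon\mathcal{C}\to\mathcal{C}/\mathcal{Z}$ satisfies the following properties: (1) $\Sigma$ sends trivial objects (objects of $\mathcal{Z}$) to zero objects and $\mathcal{Z}$-trivial morphisms to zero morphisms; (2) $\Sigma$ is an additive torsion theory functor (with respect to the torsion theory in (3) on the codomain); (3) $(\Sigma(\mathcal{T}),\Sigma(\mathcal{F}))$ is a torsion theory in $\mathcal{C}/\mathcal{Z}$. Moreover, let $G\colon\mathcal{C}\to\mathcal{D}$ be a functor into a pointed category $\mathcal{D}$ (whose hom-sets carry a preadditive structure, so that additivity of $G$ makes sense) satisfying conditions (1), (2) and (3), that is: $G$ sends objects of $\mathcal{Z}$ to zero objects and $\mathcal{Z}$-trivial morphisms to zero morphisms; $(G(\mathcal{T}),G(\mathcal{F}))$ is a torsion theory in $\mathcal{D}$; and $G$ is an additive torsion theory functor with respect to it. Then there is a unique functor $H\colon\mathcal{C}/\mathcal{Z}\to\mathcal{D}$ such that $G=H\Sigma$.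
   Context: $\mathcal{Z}$-trivial morphisms, $\mathcal{Z}$-kernels, $\mathcal{Z}$-cokernels: let $\mathcal{Z}$ be a class of objects of a category $\mathcal{C}$. A morphism is $\mathcal{Z}$-trivial if it factors through an object of $\mathcal{Z}$; $\mathrm{Triv}(X,Y)$ denotes the class of $\mathcal{Z}$-trivial morphisms $X\to Y$. A morphism $\varepsilon\colon X\to A$ is a $\mathcal{Z}$-kernel of $f\colon A\to A'$ if $f\varepsilon$ is $\mathcal{Z}$-trivial and, whenever $\lambda\colon Y\to A$ is such that $f\lambda$ is $\mathcal{Z}$-trivial, there is a unique $\lambda'\colon Y\to X$ with $\lambda=\varepsilon\lambda'$. $\mathcal{Z}$-cokernels are defined dually. A sequence $A\xrightarrow{f}B\xrightarrow{g}C$ is a short $\mathcal{Z}$-exact sequence if $f$ is a $\mathcal{Z}$-kernel of $g$ and $g$ is a $\mathcal{Z}$-cokernel of $f$. Pretorsion theory: a pair $(\mathcal{T},\mathcal{F})$ of full subcategories of a category $\mathcal{C}$ closed under isomorphisms is a pretorsion theory in $\mathcal{C}$ with class of trivial objects $\mathcal{Z}:=\mathcal{T}\cap\mathcal{F}$ if (i) $\mathrm{Hom}(T,F)=\mathrm{Triv}(T,F)$ for all $T\in\mathcal{T}$, $F\in\mathcal{F}$; (ii) for every object $X$ of $\mathcal{C}$ there is a short $\mathcal{Z}$-exact sequence $TX\to X\to FX$ with $TX\in\mathcal{T}$ and $FX\in\mathcal{F}$ (it is unique up to isomorphism, and called the canonical short $\mathcal{Z}$-exact sequence of $X$). Torsion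 theory: a torsion theory in a pointed category (a category with a zero object) $\mathcal{B}$ is a pair $(\mathcal{T}',\mathcal{F}')$ of full subcategories closed under isomorphisms such that every morphism from an object of $\mathcal{T}'$ to an object of $\mathcal{F}'$ is zero, and for every object $X$ of $\mathcal{B}$ there is a short exact sequence $0\to T'_X\to X\to F'_X\to 0$ with $T'_X\in\mathcal{T}'$, $F'_X\in\mathcal{F}'$. Here a short exact sequence $0\to A\xrightarrow{f}B\xrightarrow{g}C\to 0$ means that $f$ is a kernel of $g$ and $g$ is a cokernel of $f$. Torsion theory functor: given a pretorsion theory $(\mathcal{T},\mathcal{F})$ in a category $\mathcal{A}$ and a pointed category $\mathcal{B}$ with a torsion theory $(\mathcal{T}',\mathcal{F}')$, a functor $G\colon\mathcal{A}\to\mathcal{B}$ is a torsion theory functor if (a) $G(\mathcal{T})\subseteq\mathcal{T}'$ and $G(\mathcal{F})\subseteq\mathcal{F}'$; (b) for every object $A$ of $\mathcal{A}$ with canonical short $\mathcal{Z}$-exact sequence $TA\to A\to FA$, the sequence $0\to GTA\to GA\to GFA\to 0$ is a short exact sequence in $\mathcal{B}$. Quotient category: for $\mathcal{C}$ additive, the $\mathcal{Z}$-trivial morphisms of a pretorsion theory form an additive ideal (each $\mathrm{Triv}(X,Y)$ is a subgroup of $\mathrm{Hom}_{\mathcal{C}}(X,Y)$, and a composite is $\mathcal{Z}$-trivial whenever one factor is). The additive category $\mathcal{C}/\mathcal{Z}$ has the same objects as $\mathcal{C}$ and $\mathrm{Hom}_{\mathcal{C}/\mathcal{Z}}(X,Y):=\mathrm{Hom}_{\mathcal{C}}(X,Y)/\mathrm{Triv}(X,Y)$;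 $\Sigma\colon\mathcal{C}\to\mathcal{C}/\mathcal{Z}$ is the canonical functor, the identity on objects and the quotient map on morphisms. For a functor $G$ and a full subcategory $\mathcal{T}$ of its domain, $G(\mathcal{T})$ denotes the full subcategory of the codomain on the objects $G(X)$ with $X\in\mathcal{T}$. *)

theory Defs
  imports "HOL-Algebra.Coset"
begin

section \<open>Categories and functors\<close>

record ('o, 'm) cat =
  Obj :: "'o set"
  Arr :: "'m set"
  Dom :: "'m \<Rightarrow> 'o"
  Cod :: "'m \<Rightarrow> 'o"
  Ident :: "'o \<Rightarrow> 'm"
  Comp :: "'m \<Rightarrow> 'm \<Rightarrow> 'm"  (infixl "\<cdot>\<index>" 70)

definition Hom :: "('o, 'm, 'r) cat_scheme \<Rightarrow> 'o \<Rightarrow> 'o \<Rightarrow> 'm set" where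
  "Hom C X Y = {f \<in> Arr C. Dom C f = X \<and> Cod C f = Y}"

locale category =
  fixes C :: "('o, 'm, 'r) cat_scheme" (structure)
  assumes Dom_Obj: "f \<in> Arr C \<Longrightarrow> Dom C f \<in> Obj C"
    and Cod_Obj: "f \<in> Arr C \<Longrightarrow> Cod C f \<in> Obj C"
    and Ident_Hom: "X \<in> Obj C \<Longrightarrow> Ident C X \<in> Hom C X X"
    and Comp_Hom: "\<lbrakk>f \<in> Hom C X Y; g \<in> Hom C Y Z\<rbrakk> \<Longrightarrow> g \<cdot> f \<in> Hom C X Z"
    and Comp_Ident: "f \<in> Hom C X Y \<Longrightarrow> f \<cdot> Ident C X = f"
    and Ident_Comp: "f \<in> Hom C X Y \<Longrightarrow> Ident C Y \<cdot> f = f"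
    and Comp_assoc: "\<lbrakk>f \<in> Hom C W X; g \<in> Hom C X Y; h \<in> Hom C Y Z\<rbrakk>
      \<Longrightarrow> h \<cdot> g \<cdot> f = h \<cdot> (g \<cdot> f)"

definition isomorphic_objects :: "('o, 'm, 'r) cat_scheme \<Rightarrow> 'o \<Rightarrow> 'o \<Rightarrow> bool" where
  "isomorphic_objects C X Y \<longleftrightarrow>
    (\<exists>f \<in> Hom C X Y. \<exists>g \<in> Hom C Y X. g \<cdot>\<^bsub>C\<^esub> f = Ident C X \<and> f \<cdot>\<^bsub>C\<^esub> g = Ident C Y)"

text \<open>A full subcategory is given by its set of objects.\<close>

definition replete_full_subcategory :: "('o, 'm, 'r) cat_scheme \<Rightarrow> 'o set \<Rightarrow> bool" where
  "replete_full_subcategory C S \<longleftrightarrow>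
    S \<subseteq> Obj C \<and> (\<forall>X \<in> S. \<forall>Y \<in> Obj C. isomorphic_objects C X Y \<longrightarrow> Y \<in> S)"

record ('o, 'm, 'p, 'q) fctr =
  on_obj :: "'o \<Rightarrow> 'p"
  on_arr :: "'m \<Rightarrow> 'q"

locale is_functor = dom: category A + cod: category B
  for A :: "('o, 'm, 'r) cat_scheme" and B :: "('p, 'q, 's) cat_scheme" +
  fixes G :: "('o, 'm, 'p, 'q) fctr"
  assumes on_obj_Obj: "X \<in> Obj A \<Longrightarrow> on_obj G X \<in> Obj B"
    and on_arr_Hom: "f \<in> Hom A X Y \<Longrightarrow> on_arr G f \<in> Hom B (on_obj G X) (on_obj G Y)"
    and on_arr_Ident: "X \<in> Obj A \<Longrightarrow> on_arr G (Ident A X) = Ident B (on_obj G X)"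
    and on_arr_Comp: "\<lbrakk>f \<in> Hom A X Y; g \<in> Hom A Y Z\<rbrakk>
      \<Longrightarrow> on_arr G (g \<cdot>\<^bsub>A\<^esub> f) = on_arr G g \<cdot>\<^bsub>B\<^esub> on_arr G f"

text \<open>Functors with domain \<open>A\<close> are equal if they agree on the objects and the arrows of \<open>A\<close>;
  the values of the underlying total functions elsewhere are irrelevant.\<close>

definition functor_eq ::
  "('o, 'm, 'r) cat_scheme \<Rightarrow> ('o, 'm, 'p, 'q) fctr \<Rightarrow> ('o, 'm, 'p, 'q) fctr \<Rightarrow> bool" where
  "functor_eq A G G' \<longleftrightarrow>
    (\<forall>X \<in> Obj A. on_obj G X = on_obj G' X) \<and> (\<forall>f \<in> Arr A. on_arr G f = on_arr G' f)"

definition functor_comp ::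
  "('p, 'q, 's, 't) fctr \<Rightarrow> ('o, 'm, 'p, 'q) fctr \<Rightarrow> ('o, 'm, 's, 't) fctr" where
  "functor_comp H G = \<lparr>on_obj = on_obj H \<circ> on_obj G, on_arr = on_arr H \<circ> on_arr G\<rparr>"


section \<open>Trivial morphisms, kernels and cokernels relative to a class of objects\<close>

definition ztrivial :: "('o, 'm, 'r) cat_scheme \<Rightarrow> 'o set \<Rightarrow> 'm \<Rightarrow> bool" where
  "ztrivial C Z f \<longleftrightarrow> f \<in> Arr C \<and>
    (\<exists>V \<in> Z. \<exists>a \<in> Hom C (Dom C f) V. \<exists>b \<in> Hom C V (Cod C f). f = b \<cdot>\<^bsub>C\<^esub> a)"

definition Triv :: "('o, 'm, 'r) cat_scheme \<Rightarrow> 'o set \<Rightarrow> 'o \<Rightarrow> 'o \<Rightarrow> 'm set" where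
  "Triv C Z X Y = {f \<in> Hom C X Y. ztrivial C Z f}"

definition zkernel :: "('o, 'm, 'r) cat_scheme \<Rightarrow> 'o set \<Rightarrow> 'm \<Rightarrow> 'm \<Rightarrow> bool" where
  "zkernel C Z e f \<longleftrightarrow> e \<in> Arr C \<and> f \<in> Arr C \<and> Cod C e = Dom C f \<and> ztrivial C Z (f \<cdot>\<^bsub>C\<^esub> e) \<and>
    (\<forall>l \<in> Arr C. Cod C l = Dom C f \<and> ztrivial C Z (f \<cdot>\<^bsub>C\<^esub> l) \<longrightarrow>
      (\<exists>!k. k \<in> Hom C (Dom C l) (Dom C e) \<and> l = e \<cdot>\<^bsub>C\<^esub> k))"

definition zcokernel :: "('o, 'm, 'r) cat_scheme \<Rightarrow> 'o set \<Rightarrow> 'm \<Rightarrow> 'm \<Rightarrow> bool" where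
  "zcokernel C Z p f \<longleftrightarrow> p \<in> Arr C \<and> f \<in> Arr C \<and> Dom C p = Cod C f \<and> ztrivial C Z (p \<cdot>\<^bsub>C\<^esub> f) \<and>
    (\<forall>l \<in> Arr C. Dom C l = Cod C f \<and> ztrivial C Z (l \<cdot>\<^bsub>C\<^esub> f) \<longrightarrow>
      (\<exists>!k. k \<in> Hom C (Cod C p) (Cod C l) \<and> l = k \<cdot>\<^bsub>C\<^esub> p))"

definition short_zexact :: "('o, 'm, 'r) cat_scheme \<Rightarrow> 'o set \<Rightarrow> 'm \<Rightarrow> 'm \<Rightarrow> bool" where
  "short_zexact C Z f g \<longleftrightarrow> zkernel C Z f g \<and> zcokernel C Z g f"

definition pretorsion_theory :: "('o, 'm, 'r) cat_scheme \<Rightarrow> 'o set \<Rightarrow> 'o set \<Rightarrow> bool" where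
  "pretorsion_theory C T F \<longleftrightarrow> category C \<and>
    replete_full_subcategory C T \<and> replete_full_subcategory C F \<and>
    (\<forall>X \<in> T. \<forall>Y \<in> F. Hom C X Y = Triv C (T \<inter> F) X Y) \<and>
    (\<forall>X \<in> Obj C. \<exists>TX \<in> T. \<exists>FX \<in> F. \<exists>f \<in> Hom C TX X. \<exists>g \<in> Hom C X FX.
      short_zexact C (T \<inter> F) f g)"


section \<open>Pointed categories and torsion theories\<close>

definition zero_object :: "('o, 'm, 'r) cat_scheme \<Rightarrow> 'o \<Rightarrow> bool" where
  "zero_object C N \<longleftrightarrow> N \<in> Obj C \<and>
    (\<forall>X \<in> Obj C. (\<exists>!f. f \<in> Hom C X N) \<and> (\<exists>!f. f \<in> Hom C N X))"

definition zero_morphism :: "('o, 'm, 'r) cat_scheme \<Rightarrow> 'm \<Rightarrow> bool" where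
  "zero_morphism C f \<longleftrightarrow> f \<in> Arr C \<and>
    (\<exists>N. zero_object C N \<and>
      (\<exists>a \<in> Hom C (Dom C f) N. \<exists>b \<in> Hom C N (Cod C f). f = b \<cdot>\<^bsub>C\<^esub> a))"

locale pointed_category = category +
  assumes ex_zero_object: "\<exists>N. zero_object C N"

definition is_kernel :: "('o, 'm, 'r) cat_scheme \<Rightarrow> 'm \<Rightarrow> 'm \<Rightarrow> bool" where
  "is_kernel C e f \<longleftrightarrow> e \<in> Arr C \<and> f \<in> Arr C \<and> Cod C e = Dom C f \<and> zero_morphism C (f \<cdot>\<^bsub>C\<^esub> e) \<and>
    (\<forall>l \<in> Arr C. Cod C l = Dom C f \<and> zero_morphism C (f \<cdot>\<^bsub>C\<^esub> l) \<longrightarrow>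
      (\<exists>!k. k \<in> Hom C (Dom C l) (Dom C e) \<and> l = e \<cdot>\<^bsub>C\<^esub> k))"

definition is_cokernel :: "('o, 'm, 'r) cat_scheme \<Rightarrow> 'm \<Rightarrow> 'm \<Rightarrow> bool" where
  "is_cokernel C p f \<longleftrightarrow> p \<in> Arr C \<and> f \<in> Arr C \<and> Dom C p = Cod C f \<and> zero_morphism C (p \<cdot>\<^bsub>C\<^esub> f) \<and>
    (\<forall>l \<in> Arr C. Dom C l = Cod C f \<and> zero_morphism C (l \<cdot>\<^bsub>C\<^esub> f) \<longrightarrow>
      (\<exists>!k. k \<in> Hom C (Cod C p) (Cod C l) \<and> l = k \<cdot>\<^bsub>C\<^esub> p))"

definition short_exact :: "('o, 'm, 'r) cat_scheme \<Rightarrow> 'm \<Rightarrow> 'm \<Rightarrow> bool" where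
  "short_exact C f g \<longleftrightarrow> is_kernel C f g \<and> is_cokernel C g f"

definition torsion_theory :: "('o, 'm, 'r) cat_scheme \<Rightarrow> 'o set \<Rightarrow> 'o set \<Rightarrow> bool" where
  "torsion_theory B T F \<longleftrightarrow> pointed_category B \<and>
    replete_full_subcategory B T \<and> replete_full_subcategory B F \<and>
    (\<forall>X \<in> T. \<forall>Y \<in> F. \<forall>f \<in> Hom B X Y. zero_morphism B f) \<and>
    (\<forall>X \<in> Obj B. \<exists>TX \<in> T. \<exists>FX \<in> F. \<exists>f \<in> Hom B TX X. \<exists>g \<in> Hom B X FX. short_exact B f g)"

text \<open>The canonical short exact sequence of an object relative to a pretorsion theory is only
  determined up to isomorphism; the last condition is imposed on every representative.\<close>

definition torsion_theory_functor ::
  "('o, 'm, 'r) cat_scheme \<Rightarrow> 'o set \<Rightarrow> 'o set \<Rightarrow>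
   ('p, 'q, 's) cat_scheme \<Rightarrow> 'p set \<Rightarrow> 'p set \<Rightarrow> ('o, 'm, 'p, 'q) fctr \<Rightarrow> bool" where
  "torsion_theory_functor A T F B T' F' G \<longleftrightarrow>
    pretorsion_theory A T F \<and> torsion_theory B T' F' \<and> is_functor A B G \<and>
    on_obj G ` T \<subseteq> T' \<and> on_obj G ` F \<subseteq> F' \<and>
    (\<forall>X \<in> Obj A. \<forall>TX \<in> T. \<forall>FX \<in> F. \<forall>f \<in> Hom A TX X. \<forall>g \<in> Hom A X FX.
      short_zexact A (T \<inter> F) f g \<longrightarrow> short_exact B (on_arr G f) (on_arr G g))"


section \<open>Additive categories\<close>

record ('o, 'm) addcat = "('o, 'm) cat" +
  Add :: "'m \<Rightarrow> 'm \<Rightarrow> 'm"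
  Zero :: "'o \<Rightarrow> 'o \<Rightarrow> 'm"

text \<open>The abelian group \<open>Hom(X,Y)\<close>, with addition as the monoid operation of \<open>HOL-Algebra\<close>.\<close>

definition hom_group :: "('o, 'm, 'r) addcat_scheme \<Rightarrow> 'o \<Rightarrow> 'o \<Rightarrow> 'm monoid" where
  "hom_group C X Y = \<lparr>carrier = Hom C X Y, mult = Add C, one = Zero C X Y\<rparr>"

locale preadditive_category = category C
  for C :: "('o, 'm, 'r) addcat_scheme" (structure) +
  assumes hom_group: "\<lbrakk>X \<in> Obj C; Y \<in> Obj C\<rbrakk> \<Longrightarrow> comm_group (hom_group C X Y)"
    and Comp_Add: "\<lbrakk>f \<in> Hom C X Y; f' \<in> Hom C X Y; g \<in> Hom C Y Z\<rbrakk>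
      \<Longrightarrow> g \<cdot> Add C f f' = Add C (g \<cdot> f) (g \<cdot> f')"
    and Add_Comp: "\<lbrakk>f \<in> Hom C X Y; g \<in> Hom C Y Z; g' \<in> Hom C Y Z\<rbrakk>
      \<Longrightarrow> Add C g g' \<cdot> f = Add C (g \<cdot> f) (g' \<cdot> f)"

definition is_biproduct ::
  "('o, 'm, 'r) addcat_scheme \<Rightarrow> 'o \<Rightarrow> 'o \<Rightarrow> 'o \<Rightarrow> 'm \<Rightarrow> 'm \<Rightarrow> 'm \<Rightarrow> 'm \<Rightarrow> bool" where
  "is_biproduct C X Y P i j p q \<longleftrightarrow>
    P \<in> Obj C \<and> i \<in> Hom C X P \<and> j \<in> Hom C Y P \<and> p \<in> Hom C P X \<and> q \<in> Hom C P Y \<and>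
    p \<cdot>\<^bsub>C\<^esub> i = Ident C X \<and> q \<cdot>\<^bsub>C\<^esub> j = Ident C Y \<and>
    q \<cdot>\<^bsub>C\<^esub> i = Zero C X Y \<and> p \<cdot>\<^bsub>C\<^esub> j = Zero C Y X \<and>
    Add C (i \<cdot>\<^bsub>C\<^esub> p) (j \<cdot>\<^bsub>C\<^esub> q) = Ident C P"

locale additive_category = preadditive_category C + pointed_category C
  for C :: "('o, 'm, 'r) addcat_scheme" (structure) +
  assumes ex_biproduct:
    "\<lbrakk>X \<in> Obj C; Y \<in> Obj C\<rbrakk> \<Longrightarrow> \<exists>P i j p q. is_biproduct C X Y P i j p q"

definition additive_functor ::
  "('o, 'm, 'r) addcat_scheme \<Rightarrow> ('p, 'q, 's) addcat_scheme \<Rightarrow> ('o, 'm, 'p, 'q) fctr \<Rightarrow> bool" where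
  "additive_functor A B G \<longleftrightarrow>
    preadditive_category A \<and> preadditive_category B \<and> is_functor A B G \<and>
    (\<forall>X \<in> Obj A. \<forall>Y \<in> Obj A.
      on_arr G \<in> hom (hom_group A X Y) (hom_group B (on_obj G X) (on_obj G Y)))"


section \<open>The quotient category\<close>

text \<open>The arrows of \<open>C/Z\<close> are the cosets of the groups \<open>Triv(X,Y)\<close> in \<open>Hom(X,Y)\<close>. Distinct
  homs of \<open>C\<close> are disjoint, so an arrow of \<open>C/Z\<close> determines its domain and codomain.\<close>

definition triv_coset :: "('o, 'm, 'r) addcat_scheme \<Rightarrow> 'o set \<Rightarrow> 'm \<Rightarrow> 'm set" where
  "triv_coset C Z f =
    Triv C Z (Dom C f) (Cod C f) #>\<^bsub>hom_group C (Dom C f) (Cod C f)\<^esub> f"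

definition quotient_category ::
  "('o, 'm, 'r) addcat_scheme \<Rightarrow> 'o set \<Rightarrow> ('o, 'm set) addcat" where
  "quotient_category C Z =
    \<lparr>Obj = Obj C,
     Arr = (\<Union>X \<in> Obj C. \<Union>Y \<in> Obj C. carrier (hom_group C X Y Mod Triv C Z X Y)),
     Dom = (\<lambda>u. THE X. \<exists>f \<in> u. X = Dom C f),
     Cod = (\<lambda>u. THE Y. \<exists>f \<in> u. Y = Cod C f),
     Ident = (\<lambda>X. triv_coset C Z (Ident C X)),
     Comp = (\<lambda>v u. \<Union>g \<in> v. \<Union>f \<in> u. triv_coset C Z (g \<cdot>\<^bsub>C\<^esub> f)),
     Add = (\<lambda>u v. {Add C f g | f g. f \<in> u \<and> g \<in> v}),
     Zero = (\<lambda>X Y. Triv C Z X Y)\<rparr>"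

definition quotient_functor ::
  "('o, 'm, 'r) addcat_scheme \<Rightarrow> 'o set \<Rightarrow> ('o, 'm, 'o, 'm set) fctr" where
  "quotient_functor C Z = \<lparr>on_obj = (\<lambda>X. X), on_arr = triv_coset C Z\<rparr>"

text \<open>With this encoding the group of morphisms \<open>X \<rightarrow> Y\<close> of \<open>C/Z\<close> is literally the quotient group
  \<open>Hom(X,Y)/Triv(X,Y)\<close>.\<close>

lemma hom_group_quotient_category:
  fixes C :: "('o, 'm, 'r) addcat_scheme"
  assumes pre: "preadditive_category C"
    and triv: "\<And>X Y. \<lbrakk>X \<in> Obj C; Y \<in> Obj C\<rbrakk> \<Longrightarrow> subgroup (Triv C Z X Y) (hom_group C X Y)"
    and X: "X \<in> Obj C" and Y: "Y \<in> Obj C"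
  shows "hom_group (quotient_category C Z) X Y = hom_group C X Y Mod Triv C Z X Y"
proof -
  let ?Q = "quotient_category C Z"
  have DC: "Dom ?Q u = V \<and> Cod ?Q u = W"
    if "V \<in> Obj C" "W \<in> Obj C" "u \<in> carrier (hom_group C V W Mod Triv C Z V W)" for V W u
  proof -
    interpret comm_group "hom_group C V W"
      using pre that by (simp add: preadditive_category.hom_group)
    have "u \<in> rcosets\<^bsub>hom_group C V W\<^esub> Triv C Z V W"
      using that by (simp add: FactGroup_def)
    then have "u \<subseteq> carrier (hom_group C V W)" "u \<noteq> {}"
      using triv[OF that(1,2)]
      by (auto simp: RCOSETS_def intro: rcos_self
          dest: r_coset_subset_G[OF subgroup.subset, THEN subsetD])
    then have "u \<subseteq> Hom C V W" "\<exists>f. f \<in> u"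
      by (auto simp: hom_group_def)
    then have "(\<exists>f \<in> u. A = Dom C f) \<longleftrightarrow> A = V" "(\<exists>f \<in> u. B = Cod C f) \<longleftrightarrow> B = W" for A B
      by (auto simp: Hom_def)
    then show ?thesis
      by (simp add: quotient_category_def)
  qed
  have "Hom ?Q X Y = carrier (hom_group C X Y Mod Triv C Z X Y)"
  proof
    show "Hom ?Q X Y \<subseteq> carrier (hom_group C X Y Mod Triv C Z X Y)"
    proof
      fix u assume u: "u \<in> Hom ?Q X Y"
      then obtain V W where VW: "V \<in> Obj C" "W \<in> Obj C"
        "u \<in> carrier (hom_group C V W Mod Triv C Z V W)"
        by (auto simp: Hom_def quotient_category_def)
      with DC[OF VW] u show "u \<in> carrier (hom_group C X Y Mod Triv C Z X Y)"
        by (auto simp: Hom_def)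
    qed
    show "carrier (hom_group C X Y Mod Triv C Z X Y) \<subseteq> Hom ?Q X Y"
      using DC[OF X Y] X Y by (auto simp: Hom_def quotient_category_def)
  qed
  moreover have "Add ?Q = set_mult (hom_group C X Y)"
    by (auto simp: fun_eq_iff quotient_category_def set_mult_def hom_group_def)
  ultimately show ?thesis
    by (simp add: hom_group_def[of ?Q] FactGroup_def)
      (simp add: quotient_category_def)
qed

end

theory Submission
  imports Defs
begin

text \<open>
  The Z-trivial morphisms are closed under sums because T and F, hence Z, are closed under
  biproducts: if P is a biproduct of two objects of T, its injections lift to the torsion part of P,
  so the Z-kernel into P is a split epimorphism and hence invertible. The same splitting argument
  shows that an object which is a retract of an object of T modulo trivial morphisms already lies
  in T, which makes T replete in C/Z. A short Z-exact sequence stays exact in C/Z because Z-kernels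
  reflect triviality: if \<open>e h\<close> factors through an object V of Z, the morphism from V
  lifts along the Z-kernel e, so h factors through V as well. Statements about F and
  Z-cokernels follow by passing to the opposite category.
\<close>

section \<open>Hom-sets and trivial morphisms\<close>

context category
begin

lemma Hom_Obj: "f \<in> Hom C X Y \<Longrightarrow> X \<in> Obj C \<and> Y \<in> Obj C"
  by (auto simp: Hom_def Dom_Obj Cod_Obj)

lemma Hom_DomCod: "f \<in> Hom C X Y \<Longrightarrow> Dom C f = X \<and> Cod C f = Y \<and> f \<in> Arr C"
  by (auto simp: Hom_def)

lemma Arr_Hom: "f \<in> Arr C \<Longrightarrow> f \<in> Hom C (Dom C f) (Cod C f)"
  by (auto simp: Hom_def)

lemma Triv_iff:
  "f \<in> Triv C Z X Y \<longleftrightarrow> (\<exists>V \<in> Z. \<exists>a \<in> Hom C X V. \<exists>b \<in> Hom C V Y. f = b \<cdot> a)"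
proof
  assume "f \<in> Triv C Z X Y"
  then show "\<exists>V \<in> Z. \<exists>a \<in> Hom C X V. \<exists>b \<in> Hom C V Y. f = b \<cdot> a"
    by (auto simp: Triv_def ztrivial_def Hom_def)
next
  assume "\<exists>V \<in> Z. \<exists>a \<in> Hom C X V. \<exists>b \<in> Hom C V Y. f = b \<cdot> a"
  then obtain V a b where V: "V \<in> Z" "a \<in> Hom C X V" "b \<in> Hom C V Y" "f = b \<cdot> a"
    by blast
  then have "f \<in> Hom C X Y"
    using Comp_Hom by blast
  with V show "f \<in> Triv C Z X Y"
    unfolding Triv_def ztrivial_def using Hom_DomCod by blast
qed

lemma ztrivial_iff: "f \<in> Hom C X Y \<Longrightarrow> ztrivial C Z f \<longleftrightarrow> f \<in> Triv C Z X Y"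
  by (simp add: Triv_def)

lemma Triv_Hom: "f \<in> Triv C Z X Y \<Longrightarrow> f \<in> Hom C X Y"
  by (simp add: Triv_def)

lemma Comp_Triv:
  assumes "f \<in> Triv C Z X Y" "g \<in> Hom C Y W"
  shows "g \<cdot> f \<in> Triv C Z X W"
proof -
  obtain V a b where "V \<in> Z" and ab: "a \<in> Hom C X V" "b \<in> Hom C V Y" and "f = b \<cdot> a"
    using assms(1) by (auto simp: Triv_iff)
  moreover have "g \<cdot> b \<in> Hom C V W" "g \<cdot> (b \<cdot> a) = g \<cdot> b \<cdot> a"
    using ab assms(2) Comp_Hom Comp_assoc by metis+
  ultimately show ?thesis
    unfolding Triv_iff by blast
qed

lemma Triv_Comp:
  assumes "f \<in> Hom C X Y" "g \<in> Triv C Z Y W"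
  shows "g \<cdot> f \<in> Triv C Z X W"
proof -
  obtain V a b where "V \<in> Z" and ab: "a \<in> Hom C Y V" "b \<in> Hom C V W" and "g = b \<cdot> a"
    using assms(2) by (auto simp: Triv_iff)
  moreover have "a \<cdot> f \<in> Hom C X V" "b \<cdot> a \<cdot> f = b \<cdot> (a \<cdot> f)"
    using ab assms(1) Comp_Hom Comp_assoc by metis+
  ultimately show ?thesis
    unfolding Triv_iff by blast
qed

lemma Hom_Triv_left: "\<lbrakk>V \<in> Z; f \<in> Hom C V Y\<rbrakk> \<Longrightarrow> f \<in> Triv C Z V Y"
  unfolding Triv_iff by (metis Comp_Ident Hom_Obj Ident_Hom)

lemma Hom_Triv_right: "\<lbrakk>V \<in> Z; f \<in> Hom C X V\<rbrakk> \<Longrightarrow> f \<in> Triv C Z X V"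
  unfolding Triv_iff by (metis Ident_Comp Hom_Obj Ident_Hom)

section \<open>Z-kernels: lifting, cancellation and splitting\<close>

lemma zkernel_trivial:
  assumes "zkernel C Z e f" "e \<in> Hom C X A" "f \<in> Hom C A B"
  shows "f \<cdot> e \<in> Triv C Z X B"
proof -
  have "f \<cdot> e \<in> Hom C X B"
    using assms(2,3) by (rule Comp_Hom)
  with assms(1) show ?thesis
    by (simp add: zkernel_def ztrivial_iff)
qed

lemma zkernel_lift:
  assumes "zkernel C Z e f" "e \<in> Hom C X A" "f \<in> Hom C A B"
    and l: "l \<in> Hom C Y A" "f \<cdot> l \<in> Triv C Z Y B"
  shows "\<exists>!k. k \<in> Hom C Y X \<and> l = e \<cdot> k"
proof -
  have dc: "Dom C f = A" "Dom C e = X" "Dom C l = Y" "Cod C l = A" "l \<in> Arr C"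
    using assms(2,3) l(1) by (simp_all add: Hom_def)
  have "ztrivial C Z (f \<cdot> l)"
    using l(2) by (simp add: Triv_def)
  moreover have "\<forall>l \<in> Arr C. Cod C l = Dom C f \<and> ztrivial C Z (f \<cdot> l) \<longrightarrow>
      (\<exists>!k. k \<in> Hom C (Dom C l) (Dom C e) \<and> l = e \<cdot> k)"
    using assms(1) unfolding zkernel_def by (elim conjE)
  ultimately have "\<exists>!k. k \<in> Hom C (Dom C l) (Dom C e) \<and> l = e \<cdot> k"
    using dc(1,4,5) by metis
  then show ?thesis
    unfolding dc .
qed

text \<open>Both morphisms are lifts of \<open>e \<cdot> k\<close> along \<open>e\<close>. Such a
  lift is unique because \<open>f \<cdot> (e \<cdot> k)\<close> is trivial, as
  \<open>f \<cdot> e\<close> is.\<close>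

lemma zkernel_mono:
  assumes ker: "zkernel C Z e f" "e \<in> Hom C X A" "f \<in> Hom C A B"
    and k: "k \<in> Hom C Y X" "k' \<in> Hom C Y X" "e \<cdot> k = e \<cdot> k'"
  shows "k = k'"
proof -
  have ek: "e \<cdot> k \<in> Hom C Y A"
    using ker(2) k(1) Comp_Hom by blast
  have "f \<cdot> e \<cdot> k \<in> Triv C Z Y B"
    using Triv_Comp zkernel_trivial[OF ker] k(1) by blast
  then have "f \<cdot> (e \<cdot> k) \<in> Triv C Z Y B"
    using Comp_assoc[OF k(1) ker(2,3)] by simp
  from zkernel_lift[OF ker ek this] k show ?thesis
    by blast
qed

text \<open>A split epimorphism that can be cancelled on the left is invertible:
  \<open>e \<cdot> (k \<cdot> e) = e\<close>, so \<open>k \<cdot> e\<close> is an identity as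
  well.\<close>

lemma zkernel_split_iso:
  assumes ker: "zkernel C Z e f" "e \<in> Hom C X A" "f \<in> Hom C A B"
    and k: "k \<in> Hom C A X" "e \<cdot> k = Ident C A"
  shows "isomorphic_objects C X A"
proof -
  have "e \<cdot> (k \<cdot> e) = e \<cdot> Ident C X"
    using Comp_assoc[OF ker(2) k(1) ker(2)] k(2) Ident_Comp[OF ker(2)] Comp_Ident[OF ker(2)]
    by simp
  then have "k \<cdot> e = Ident C X"
    using zkernel_mono[OF ker, of "k \<cdot> e" X "Ident C X"] Comp_Hom[OF ker(2) k(1)]
      Hom_Obj[OF ker(2)] Ident_Hom by blast
  with ker(2) k show ?thesis
    unfolding isomorphic_objects_def by blast
qed

end


section \<open>Preadditive categories\<close>

lemma hom_group_sel [simp]: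
  "carrier (hom_group C X Y) = Hom C X Y" "mult (hom_group C X Y) = Add C"
  "one (hom_group C X Y) = Zero C X Y"
  by (simp_all add: hom_group_def)

context preadditive_category
begin

text \<open>Subtraction of parallel morphisms. The hom-group is read off from the first argument, so
  that no objects have to be supplied.\<close>

definition diff :: "'m \<Rightarrow> 'm \<Rightarrow> 'm" where
  "diff f g = Add C f (inv\<^bsub>hom_group C (Dom C f) (Cod C f)\<^esub> g)"

lemma diff_eq: "f \<in> Hom C X Y \<Longrightarrow> diff f g = Add C f (inv\<^bsub>hom_group C X Y\<^esub> g)"
  by (auto simp: diff_def Hom_def)

lemma hom_group_at: "f \<in> Hom C X Y \<Longrightarrow> comm_group (hom_group C X Y)"
  using Hom_Obj hom_group by blast

lemma Add_Hom:
  assumes "f \<in> Hom C X Y" "g \<in> Hom C X Y"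
  shows "Add C f g \<in> Hom C X Y"
proof -
  interpret comm_group "hom_group C X Y"
    using assms(1) by (rule hom_group_at)
  show ?thesis
    using m_closed[of f g] assms by simp
qed

lemma Zero_Hom:
  assumes "X \<in> Obj C" "Y \<in> Obj C"
  shows "Zero C X Y \<in> Hom C X Y"
proof -
  interpret comm_group "hom_group C X Y"
    using assms by (rule hom_group)
  show ?thesis
    using one_closed by simp
qed

lemma inv_Hom:
  assumes "f \<in> Hom C X Y"
  shows "inv\<^bsub>hom_group C X Y\<^esub> f \<in> Hom C X Y"
proof -
  interpret comm_group "hom_group C X Y"
    using assms by (rule hom_group_at)
  show ?thesis
    using inv_closed[of f] assms by simp
qed

lemma diff_Hom: "\<lbrakk>f \<in> Hom C X Y; g \<in> Hom C X Y\<rbrakk> \<Longrightarrow> diff f g \<in> Hom C X Y"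
  by (simp add: diff_eq Add_Hom inv_Hom)

lemma diff_Add_cancel:
  assumes "f \<in> Hom C X Y" "g \<in> Hom C X Y"
  shows "Add C (diff f g) g = f"
proof -
  interpret comm_group "hom_group C X Y"
    using assms(1) by (rule hom_group_at)
  show ?thesis
    using inv_solve_right[of "diff f g" f g] assms diff_Hom[OF assms] diff_eq[OF assms(1), of g]
    by simp
qed

text \<open>With \<open>diff_Add_cancel\<close> this says that \<open>diff f g\<close> is the only
  solution \<open>d\<close> of \<open>d + g = f\<close>. That is how composition is shown below to
  distribute over \<open>diff\<close>.\<close>

lemma diff_unique:
  assumes "d \<in> Hom C X Y" "g \<in> Hom C X Y"
  shows "diff (Add C d g) g = d"
proof -
  interpret comm_group "hom_group C X Y"
    using assms(1) by (rule hom_group_at)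
  have "d \<otimes>\<^bsub>hom_group C X Y\<^esub> g \<otimes>\<^bsub>hom_group C X Y\<^esub> inv\<^bsub>hom_group C X Y\<^esub> g = d"
    using assms inv_solve_right[of d "d \<otimes>\<^bsub>hom_group C X Y\<^esub> g" g] Add_Hom[OF assms] by simp
  then show ?thesis
    using diff_eq[OF Add_Hom[OF assms]] by simp
qed

lemma Comp_diff:
  assumes "f \<in> Hom C X Y" "f' \<in> Hom C X Y" "g \<in> Hom C Y W"
  shows "g \<cdot> diff f f' = diff (g \<cdot> f) (g \<cdot> f')"
  using Comp_Add[OF diff_Hom[OF assms(1,2)] assms(2,3)] diff_Add_cancel[OF assms(1,2)]
    diff_unique[OF Comp_Hom[OF diff_Hom[OF assms(1,2)] assms(3)] Comp_Hom[OF assms(2,3)]]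
  by simp

lemma diff_Comp:
  assumes "f \<in> Hom C X Y" "g \<in> Hom C Y W" "g' \<in> Hom C Y W"
  shows "diff g g' \<cdot> f = diff (g \<cdot> f) (g' \<cdot> f)"
  using Add_Comp[OF assms(1) diff_Hom[OF assms(2,3)] assms(3)] diff_Add_cancel[OF assms(2,3)]
    diff_unique[OF Comp_Hom[OF assms(1) diff_Hom[OF assms(2,3)]] Comp_Hom[OF assms(1,3)]]
  by simp

lemma diff_self:
  assumes "f \<in> Hom C X Y"
  shows "diff f f = Zero C X Y"
proof -
  interpret comm_group "hom_group C X Y"
    using assms by (rule hom_group_at)
  show ?thesis
    using r_inv[of f] assms by (simp add: diff_eq)
qed

text \<open>Zero is the difference of a morphism with itself, and composition preserves
  differences.\<close>

lemma Comp_Zero: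
  assumes "X \<in> Obj C" "g \<in> Hom C Y W"
  shows "g \<cdot> Zero C X Y = Zero C X W"
proof -
  have z: "Zero C X Y \<in> Hom C X Y"
    using Zero_Hom assms Hom_Obj by blast
  then show ?thesis
    using Comp_diff[OF z z assms(2)] diff_self[OF z] diff_self[OF Comp_Hom[OF z assms(2)]] by simp
qed

lemma Zero_Comp:
  assumes "W \<in> Obj C" "f \<in> Hom C X Y"
  shows "Zero C Y W \<cdot> f = Zero C X W"
proof -
  have z: "Zero C Y W \<in> Hom C Y W"
    using Zero_Hom assms Hom_Obj by blast
  then show ?thesis
    using diff_Comp[OF assms(2) z z] diff_self[OF z] diff_self[OF Comp_Hom[OF assms(2) z]] by simp
qed

text \<open>Distributivity gives \<open>(-g) f + g f = 0 f = 0\<close>, and inverses in a group are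
  unique.\<close>

lemma inv_Comp:
  assumes "f \<in> Hom C X Y" "g \<in> Hom C Y W"
  shows "inv\<^bsub>hom_group C X W\<^esub> (g \<cdot> f) = inv\<^bsub>hom_group C Y W\<^esub> g \<cdot> f"
proof -
  have gf: "g \<cdot> f \<in> Hom C X W"
    using assms by (rule Comp_Hom)
  interpret YW: comm_group "hom_group C Y W"
    using assms(2) by (rule hom_group_at)
  interpret XW: comm_group "hom_group C X W"
    using gf by (rule hom_group_at)
  have i: "inv\<^bsub>hom_group C Y W\<^esub> g \<in> Hom C Y W"
    using assms(2) by (rule inv_Hom)
  have "Add C (inv\<^bsub>hom_group C Y W\<^esub> g) g = Zero C Y W"
    using YW.l_inv[of g] assms(2) by simp
  then have "Add C (inv\<^bsub>hom_group C Y W\<^esub> g \<cdot> f) (g \<cdot> f) = Zero C X W"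
    using Add_Comp[OF assms(1) i assms(2)] Zero_Comp[OF _ assms(1)] Hom_Obj[OF assms(2)] by simp
  then show ?thesis
    using XW.inv_equality[of "inv\<^bsub>hom_group C Y W\<^esub> g \<cdot> f" "g \<cdot> f"] gf Comp_Hom[OF assms(1) i]
    by simp
qed

text \<open>Reconciles the two notions of zero, factoring through a zero object and being the
  neutral element of the hom-group. They agree because a hom-set into a zero object is a
  singleton.\<close>

lemma zero_morphism_iff:
  assumes "\<exists>N. zero_object C N" "f \<in> Hom C X Y"
  shows "zero_morphism C f \<longleftrightarrow> f = Zero C X Y"
proof
  assume "zero_morphism C f"
  then obtain N a b where N: "zero_object C N" and ab: "a \<in> Hom C X N" "b \<in> Hom C N Y" "f = b \<cdot> a"
    using assms(2) by (auto simp: zero_morphism_def Hom_def)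
  have "X \<in> Obj C" "N \<in> Obj C"
    using Hom_Obj ab by blast+
  then have "a = Zero C X N"
    using N ab(1) Zero_Hom by (auto simp: zero_object_def)
  then show "f = Zero C X Y"
    using ab Comp_Zero \<open>X \<in> Obj C\<close> by simp
next
  assume f: "f = Zero C X Y"
  obtain N where N: "zero_object C N"
    using assms(1) by blast
  have obj: "X \<in> Obj C" "Y \<in> Obj C" "N \<in> Obj C"
    using Hom_Obj assms(2) N by (auto simp: zero_object_def)
  then have "f = Zero C N Y \<cdot> Zero C X N"
    using f Comp_Zero[OF obj(1) Zero_Hom[OF obj(3,2)]] by simp
  with obj N Zero_Hom assms(2) show "zero_morphism C f"
    unfolding zero_morphism_def Hom_def by blast
qed

end


section \<open>Opposite categories\<close>

text \<open>The duality device: passing to it exchanges Z-kernels with Z-cokernels and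
  \<open>T\<close> with \<open>F\<close>. Arrows and their addition stay the same, so hom-groups are
  literally those of \<open>C\<close> with the objects swapped.\<close>

definition op_cat :: "('o, 'm, 'r) addcat_scheme \<Rightarrow> ('o, 'm, 'r) addcat_scheme" where
  "op_cat C = C\<lparr>Dom := Cod C, Cod := Dom C, Comp := (\<lambda>g f. f \<cdot>\<^bsub>C\<^esub> g), Zero := (\<lambda>X Y. Zero C Y X)\<rparr>"

lemma op_cat_sel [simp]:
  "Obj (op_cat C) = Obj C" "Arr (op_cat C) = Arr C" "Dom (op_cat C) = Cod C"
  "Cod (op_cat C) = Dom C" "Ident (op_cat C) = Ident C" "g \<cdot>\<^bsub>op_cat C\<^esub> f = f \<cdot>\<^bsub>C\<^esub> g"
  "Add (op_cat C) = Add C" "Zero (op_cat C) X Y = Zero C Y X"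
  by (simp_all add: op_cat_def)

lemma Hom_op_cat [simp]: "Hom (op_cat C) X Y = Hom C Y X"
  by (auto simp: Hom_def)

lemma hom_group_op_cat [simp]: "hom_group (op_cat C) X Y = hom_group C Y X"
  by (simp add: hom_group_def)

lemma ztrivial_op_cat [simp]: "ztrivial (op_cat C) Z f = ztrivial C Z f"
  by (auto simp: ztrivial_def)

lemma Triv_op_cat [simp]: "Triv (op_cat C) Z X Y = Triv C Z Y X"
  by (simp add: Triv_def)

lemma zkernel_op_cat [simp]: "zkernel (op_cat C) Z e f = zcokernel C Z e f"
  by (auto simp: zkernel_def zcokernel_def)

lemma zcokernel_op_cat [simp]: "zcokernel (op_cat C) Z e f = zkernel C Z e f"
  by (auto simp: zkernel_def zcokernel_def)

lemma zero_object_op_cat [simp]: "zero_object (op_cat C) N = zero_object C N"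
  by (auto simp: zero_object_def)

lemma replete_op_cat [simp]: "replete_full_subcategory (op_cat C) S = replete_full_subcategory C S"
proof -
  have "isomorphic_objects (op_cat C) X Y = isomorphic_objects C X Y" for X Y
    by (auto simp: isomorphic_objects_def)
  then show ?thesis
    by (simp add: replete_full_subcategory_def)
qed

lemma category_op_cat: "category C \<Longrightarrow> category (op_cat C)"
proof -
  assume "category C"
  then interpret category C .
  show ?thesis
    by unfold_locales
      (simp_all add: Dom_Obj Cod_Obj Ident_Hom Comp_Hom Comp_Ident Ident_Comp Comp_assoc)
qed

lemma preadditive_op_cat: "preadditive_category C \<Longrightarrow> preadditive_category (op_cat C)"
proof -
  assume "preadditive_category C"
  then interpret preadditive_category C .
  show ?thesis
    by (intro preadditive_category.intro preadditive_category_axioms.intro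
        category_op_cat[OF category_axioms])
      (simp_all add: hom_group Comp_Add Add_Comp)
qed

lemma additive_op_cat:
  assumes "additive_category C"
  shows "additive_category (op_cat C)"
proof -
  interpret additive_category C
    by fact
  have "\<exists>P i j p q. is_biproduct (op_cat C) X Y P i j p q" if XY: "X \<in> Obj C" "Y \<in> Obj C" for X Y
  proof -
    obtain P i j p q where "is_biproduct C X Y P i j p q"
      using ex_biproduct[OF XY] by blast
    \<comment> \<open>Biproducts are self-dual: projections become injections and
      conversely.\<close>
    then have "is_biproduct (op_cat C) X Y P p q i j"
      by (auto simp: is_biproduct_def)
    then show ?thesis
      by blast
  qed
  then show ?thesis
    using ex_zero_object preadditive_op_cat[OF preadditive_category_axioms]
    by (simp add: additive_category_def additive_category_axioms_def pointed_category_def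
        pointed_category_axioms_def preadditive_category_def)
qed

lemma pretorsion_op_cat:
  assumes "pretorsion_theory C T F"
  shows "pretorsion_theory (op_cat C) F T"
  using assms unfolding pretorsion_theory_def short_zexact_def
  by (simp add: category_op_cat Int_commute) metis


section \<open>Pretorsion theories in additive categories\<close>

locale additive_pretorsion = additive_category C
  for C :: "('o, 'm, 'r) addcat_scheme" (structure) +
  fixes T F :: "'o set"
  assumes pretorsion: "pretorsion_theory C T F"
begin

abbreviation "Z \<equiv> T \<inter> F"

lemma op_additive_pretorsion: "additive_pretorsion (op_cat C) F T"
  by (simp add: additive_pretorsion_def additive_pretorsion_axioms_def
      additive_op_cat pretorsion_op_cat additive_category_axioms pretorsion)

section \<open>Basic facts and closure of \<open>T\<close> and \<open>F\<close> under
  biproducts\<close>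

lemma T_Obj: "X \<in> T \<Longrightarrow> X \<in> Obj C"
  using pretorsion by (auto simp: pretorsion_theory_def replete_full_subcategory_def)

lemma T_F_Triv: "\<lbrakk>X \<in> T; Y \<in> F; f \<in> Hom C X Y\<rbrakk> \<Longrightarrow> f \<in> Triv C Z X Y"
  using pretorsion by (auto simp: pretorsion_theory_def)

lemma canonical_sequence:
  assumes "X \<in> Obj C"
  obtains TX FX e n where "TX \<in> T" "FX \<in> F" "e \<in> Hom C TX X" "n \<in> Hom C X FX"
    "zkernel C Z e n" "zcokernel C Z n e"
  using pretorsion assms unfolding pretorsion_theory_def short_zexact_def by blast

lemma T_iso: "\<lbrakk>X \<in> T; isomorphic_objects C X Y; Y \<in> Obj C\<rbrakk> \<Longrightarrow> Y \<in> T"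
  using pretorsion by (auto simp: pretorsion_theory_def replete_full_subcategory_def)

lemma T_biproduct:
  assumes "X \<in> T" "Y \<in> T" and bp: "is_biproduct C X Y P i j p q"
  shows "P \<in> T"
proof -
  have P: "P \<in> Obj C" and i: "i \<in> Hom C X P" and j: "j \<in> Hom C Y P"
    and p: "p \<in> Hom C P X" and q: "q \<in> Hom C P Y" and id: "Add C (i \<cdot> p) (j \<cdot> q) = Ident C P"
    using bp by (auto simp: is_biproduct_def)
  obtain TP FP e n where TP: "TP \<in> T" "FP \<in> F" and e: "e \<in> Hom C TP P" and n: "n \<in> Hom C P FP"
    and ker: "zkernel C Z e n"
    using canonical_sequence[OF P] by metis
  \<comment> \<open>Both composites go from an object of \<open>T\<close> to one of
    \<open>F\<close>, so the injections lift along \<open>e\<close>.\<close>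
  have "n \<cdot> i \<in> Triv C Z X FP" "n \<cdot> j \<in> Triv C Z Y FP"
    using T_F_Triv assms(1,2) TP(2) Comp_Hom n i j by blast+
  then obtain k l where k: "k \<in> Hom C X TP" "i = e \<cdot> k" and l: "l \<in> Hom C Y TP" "j = e \<cdot> l"
    using zkernel_lift[OF ker e n i] zkernel_lift[OF ker e n j] by blast
  have kp: "k \<cdot> p \<in> Hom C P TP" and lq: "l \<cdot> q \<in> Hom C P TP"
    using k l p q Comp_Hom by blast+
  \<comment> \<open>The lifts assemble to a section of \<open>e\<close>: composing with
    \<open>e\<close> turns the sum into \<open>i \<cdot> p + j \<cdot> q\<close>, which is the
    identity.\<close>
  have "e \<cdot> Add C (k \<cdot> p) (l \<cdot> q) = Ident C P"
    using Comp_Add[OF kp lq e] Comp_assoc[OF p k(1) e] Comp_assoc[OF q l(1) e] k(2) l(2) id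
    by simp
  then show ?thesis
    using zkernel_split_iso[OF ker e n Add_Hom[OF kp lq]] T_iso TP(1) P by blast
qed

lemma F_biproduct:
  assumes "X \<in> F" "Y \<in> F" "is_biproduct C X Y P i j p q"
  shows "P \<in> F"
proof -
  interpret op: additive_pretorsion "op_cat C" F T
    by (rule op_additive_pretorsion)
  have "is_biproduct (op_cat C) X Y P p q i j"
    using assms(3) by (auto simp: is_biproduct_def)
  then show ?thesis
    using op.T_biproduct assms(1,2) by blast
qed

section \<open>The trivial morphisms as subgroups of the hom-groups\<close>

lemma Z_nonempty: "\<exists>V. V \<in> Z"
proof -
  obtain N where "N \<in> Obj C"
    using ex_zero_object by (auto simp: zero_object_def)
  then show ?thesis
    \<comment> \<open>The composite of the two maps in any canonical sequence is trivial, and the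
      object it factors through is a member of \<open>Z\<close>.\<close>
    by (rule canonical_sequence) (auto simp: zkernel_def ztrivial_def)
qed

text \<open>If the summands factor through \<open>V\<close> and \<open>W\<close> in
  \<open>Z\<close>, their sum factors through the biproduct of \<open>V\<close> and
  \<open>W\<close>, which is again in \<open>Z\<close>.\<close>

lemma Triv_Add:
  assumes "f \<in> Triv C Z X Y" "g \<in> Triv C Z X Y"
  shows "Add C f g \<in> Triv C Z X Y"
proof -
  obtain V a b where V: "V \<in> Z" and a: "a \<in> Hom C X V" and b: "b \<in> Hom C V Y" and f: "f = b \<cdot> a"
    using assms(1) unfolding Triv_iff by blast
  obtain W c d where W: "W \<in> Z" and c: "c \<in> Hom C X W" and d: "d \<in> Hom C W Y" and g: "g = d \<cdot> c"
    using assms(2) unfolding Triv_iff by blast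
  obtain P i j p q where bp: "is_biproduct C V W P i j p q"
    using ex_biproduct[of V W] V W T_Obj by blast
  then have P: "P \<in> Z"
    using V W T_biproduct F_biproduct by blast
  have i: "i \<in> Hom C V P" and j: "j \<in> Hom C W P" and p: "p \<in> Hom C P V" and q: "q \<in> Hom C P W"
    and eqs: "p \<cdot> i = Ident C V" "q \<cdot> j = Ident C W" "q \<cdot> i = Zero C V W" "p \<cdot> j = Zero C W V"
    using bp by (auto simp: is_biproduct_def)
  \<comment> \<open>The morphism into the biproduct with components \<open>a\<close> and
    \<open>c\<close>. The second factor will be \<open>b \<cdot> p + d \<cdot> q\<close>.\<close>
  define r where "r = Add C (i \<cdot> a) (j \<cdot> c)"
  have ia: "i \<cdot> a \<in> Hom C X P" and jc: "j \<cdot> c \<in> Hom C X P"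
    using a c i j Comp_Hom by blast+
  have r: "r \<in> Hom C X P"
    unfolding r_def using ia jc by (rule Add_Hom)
  have XVW: "X \<in> Obj C" "V \<in> Obj C" "W \<in> Obj C"
    using a c Hom_Obj by blast+
  have "p \<cdot> r = Add C a (Zero C X V)"
    using Comp_Add[OF ia jc p] Comp_assoc[OF a i p] Comp_assoc[OF c j p] eqs Ident_Comp[OF a]
      Zero_Comp[OF XVW(2) c] by (simp add: r_def)
  also have "\<dots> = a"
    using group.is_monoid[OF comm_group.axioms(2)[OF hom_group_at[OF a]]] a
      monoid.r_one[of "hom_group C X V" a] by simp
  finally have pr: "p \<cdot> r = a" .
  have "q \<cdot> r = Add C (Zero C X W) c"
    using Comp_Add[OF ia jc q] Comp_assoc[OF a i q] Comp_assoc[OF c j q] eqs Ident_Comp[OF c]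
      Zero_Comp[OF XVW(3) a] by (simp add: r_def)
  also have "\<dots> = c"
    using group.is_monoid[OF comm_group.axioms(2)[OF hom_group_at[OF c]]] c
      monoid.l_one[of "hom_group C X W" c] by simp
  finally have qr: "q \<cdot> r = c" .
  have bp: "b \<cdot> p \<in> Hom C P Y" and dq: "d \<cdot> q \<in> Hom C P Y"
    using b d p q Comp_Hom by blast+
  have "Add C (b \<cdot> p) (d \<cdot> q) \<cdot> r = Add C f g"
    using Add_Comp[OF r bp dq] Comp_assoc[OF r p b] Comp_assoc[OF r q d] pr qr f g by simp
  with P r Add_Hom[OF bp dq] show ?thesis
    unfolding Triv_iff by metis
qed

lemma Triv_subgroup:
  assumes "X \<in> Obj C" "Y \<in> Obj C"
  shows "subgroup (Triv C Z X Y) (hom_group C X Y)"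
proof -
  interpret comm_group "hom_group C X Y"
    using assms by (rule hom_group)
  obtain V where V: "V \<in> Z" "V \<in> Obj C"
    using Z_nonempty T_Obj by blast
  show ?thesis
  proof (rule subgroupI)
    show "Triv C Z X Y \<subseteq> carrier (hom_group C X Y)"
      by (auto simp: Triv_def)
    \<comment> \<open>Any composite through the trivial object \<open>V\<close> shows that the
      subgroup is nonempty; zero morphisms are always available.\<close>
    have "Zero C V Y \<cdot> Zero C X V \<in> Triv C Z X Y"
      unfolding Triv_iff using V assms Zero_Hom by blast
    then show "Triv C Z X Y \<noteq> {}"
      by blast
  next
    fix f assume "f \<in> Triv C Z X Y"
    then obtain V a b where "V \<in> Z" "a \<in> Hom C X V" "b \<in> Hom C V Y" "f = b \<cdot> a"
      unfolding Triv_iff by blast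
    then show "inv\<^bsub>hom_group C X Y\<^esub> f \<in> Triv C Z X Y"
      unfolding Triv_iff using inv_Comp inv_Hom by blast
  next
    fix f g assume "f \<in> Triv C Z X Y" "g \<in> Triv C Z X Y"
    then show "f \<otimes>\<^bsub>hom_group C X Y\<^esub> g \<in> Triv C Z X Y"
      by (simp add: Triv_Add)
  qed
qed

text \<open>The hypothesis says that \<open>Y\<close> is a retract of \<open>X\<close> in \<open>C/Z\<close>.\<close>

lemma T_retract_mod_Triv:
  assumes X: "X \<in> T" and f: "f \<in> Hom C X Y" and g: "g \<in> Hom C Y X"
    and fg: "diff (Ident C Y) (f \<cdot> g) \<in> Triv C Z Y Y"
  shows "Y \<in> T"
proof -
  have Y: "Y \<in> Obj C"
    using Hom_Obj f by blast
  have id: "Ident C Y \<in> Hom C Y Y" and fgH: "f \<cdot> g \<in> Hom C Y Y"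
    using Y f g Ident_Hom Comp_Hom by blast+
  obtain TY FY e n where TY: "TY \<in> T" "FY \<in> F" and e: "e \<in> Hom C TY Y" and n: "n \<in> Hom C Y FY"
    and ker: "zkernel C Z e n"
    using canonical_sequence[OF Y] by metis
  have "n \<cdot> f \<in> Triv C Z X FY"
    using T_F_Triv X TY(2) Comp_Hom n f by blast
  then have "n \<cdot> f \<cdot> g \<in> Triv C Z Y FY"
    using Triv_Comp g by blast
  moreover have "n \<cdot> diff (Ident C Y) (f \<cdot> g) \<in> Triv C Z Y FY"
    using Comp_Triv fg n by blast
  \<comment> \<open>Writing the identity as \<open>(1 - f g) + f g\<close> shows that its composite
    with \<open>n\<close> is a sum of trivial morphisms. Hence the identity lifts along
    \<open>e\<close> and splits it.\<close>
  moreover have "n \<cdot> Ident C Y = Add C (n \<cdot> diff (Ident C Y) (f \<cdot> g)) (n \<cdot> f \<cdot> g)"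
    using Comp_Add[OF diff_Hom[OF id fgH] fgH n] diff_Add_cancel[OF id fgH]
      Comp_assoc[OF g f n] by simp
  ultimately have "n \<cdot> Ident C Y \<in> Triv C Z Y FY"
    using Triv_Add by simp
  then obtain k where "k \<in> Hom C Y TY" "Ident C Y = e \<cdot> k"
    using zkernel_lift[OF ker e n id] by blast
  then show ?thesis
    using zkernel_split_iso[OF ker e n] T_iso TY(1) Y by metis
qed

lemma F_retract_mod_Triv:
  assumes "X \<in> F" "f \<in> Hom C X Y" "g \<in> Hom C Y X"
    and "diff (Ident C Y) (f \<cdot> g) \<in> Triv C Z Y Y"
  shows "Y \<in> F"
proof -
  interpret op: additive_pretorsion "op_cat C" F T
    by (rule op_additive_pretorsion)
  \<comment> \<open>The swap of domain and codomain cancels the swap of objects in the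
    hom-group.\<close>
  have "op.diff (Ident C Y) (f \<cdot> g) = diff (Ident C Y) (f \<cdot> g)"
    by (simp add: op.diff_def diff_def)
  then show ?thesis
    using op.T_retract_mod_Triv[of X g Y f] assms by (simp add: Int_commute)
qed

text \<open>The substitute for left cancellation of \<open>e\<close> modulo trivial morphisms; it
  yields uniqueness of factorizations through \<open>cl e\<close> in \<open>Q\<close>.\<close>

lemma zkernel_reflects_Triv:
  assumes ker: "zkernel C Z e n" "e \<in> Hom C X A" "n \<in> Hom C A B"
    and h: "h \<in> Hom C Y X" "e \<cdot> h \<in> Triv C Z Y A"
  shows "h \<in> Triv C Z Y X"
proof -
  obtain V a b where V: "V \<in> Z" and a: "a \<in> Hom C Y V" and b: "b \<in> Hom C V A" and eh: "e \<cdot> h = b \<cdot> a"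
    using h(2) unfolding Triv_iff by blast
  have "n \<cdot> b \<in> Triv C Z V B"
    using V Hom_Triv_left Comp_Hom b ker(3) by blast
  then obtain k where k: "k \<in> Hom C V X" "b = e \<cdot> k"
    using zkernel_lift[OF ker b] by blast
  have "e \<cdot> h = e \<cdot> (k \<cdot> a)"
    using eh k(2) Comp_assoc[OF a k(1) ker(2)] by simp
  then have "h = k \<cdot> a"
    using zkernel_mono[OF ker h(1)] Comp_Hom[OF a k(1)] by blast
  with V a k(1) show ?thesis
    unfolding Triv_iff by blast
qed

lemma zcokernel_reflects_Triv:
  assumes "zcokernel C Z n e" "e \<in> Hom C X A" "n \<in> Hom C A B"
    and "h \<in> Hom C B Y" "h \<cdot> n \<in> Triv C Z A Y"
  shows "h \<in> Triv C Z B Y"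
proof -
  interpret op: additive_pretorsion "op_cat C" F T
    by (rule op_additive_pretorsion)
  show ?thesis
    using op.zkernel_reflects_Triv[of n e B A X h Y] assms by (simp add: Int_commute)
qed

lemma zcokernel_extend:
  assumes "zcokernel C Z n e" "e \<in> Hom C X A" "n \<in> Hom C A B"
    and "l \<in> Hom C A Y" "l \<cdot> e \<in> Triv C Z X Y"
  shows "\<exists>!k. k \<in> Hom C B Y \<and> l = k \<cdot> n"
proof -
  interpret op: additive_pretorsion "op_cat C" F T
    by (rule op_additive_pretorsion)
  show ?thesis
    using op.zkernel_lift[of Z n e B A X l Y] assms by simp
qed


section \<open>The quotient by the trivial morphisms\<close>

abbreviation "Q \<equiv> quotient_category C Z"

section \<open>Cosets of trivial morphisms\<close>

abbreviation "cl \<equiv> triv_coset C Z"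

lemma cl_eq_rcos: "f \<in> Hom C X Y \<Longrightarrow> cl f = Triv C Z X Y #>\<^bsub>hom_group C X Y\<^esub> f"
  by (auto simp: triv_coset_def Hom_def)

lemma Triv_normal:
  assumes "X \<in> Obj C" "Y \<in> Obj C"
  shows "normal (Triv C Z X Y) (hom_group C X Y)"
  using assms by (simp add: comm_group.subgroup_imp_normal hom_group Triv_subgroup)

lemma mem_cl_iff:
  assumes f: "f \<in> Hom C X Y"
  shows "g \<in> cl f \<longleftrightarrow> g \<in> Hom C X Y \<and> diff g f \<in> Triv C Z X Y"
proof -
  interpret comm_group "hom_group C X Y"
    using f by (rule hom_group_at)
  have sub: "subgroup (Triv C Z X Y) (hom_group C X Y)"
    using f Hom_Obj Triv_subgroup by blast
  show ?thesis
  proof (cases "g \<in> Hom C X Y")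
    case True
    then show ?thesis
      using subgroup.rcos_module[OF sub is_group, of f g] f
      by (simp add: cl_eq_rcos diff_eq)
  next
    case False
    then show ?thesis
      using r_coset_subset_G[OF subgroup.subset[OF sub], of f] f by (auto simp: cl_eq_rcos)
  qed
qed

text \<open>The bridge used throughout: equality of arrows of \<open>Q\<close> becomes triviality of
  a difference in \<open>C\<close>.\<close>

lemma cl_eq_iff:
  assumes f: "f \<in> Hom C X Y" and g: "g \<in> Hom C X Y"
  shows "cl f = cl g \<longleftrightarrow> diff f g \<in> Triv C Z X Y"
proof -
  interpret comm_group "hom_group C X Y"
    using f by (rule hom_group_at)
  have sub: "subgroup (Triv C Z X Y) (hom_group C X Y)"
    using f Hom_Obj Triv_subgroup by blast
  have "f \<in> cl f"
    using rcos_self[OF _ sub] f by (simp add: cl_eq_rcos)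
  moreover have "cl f = cl g" if "f \<in> cl g"
    using repr_independence[OF _ _ sub, of f g] that f g by (simp add: cl_eq_rcos)
  ultimately show ?thesis
    using mem_cl_iff[OF g, of f] f by auto
qed

lemma cl_self:
  assumes "f \<in> Hom C X Y"
  shows "f \<in> cl f"
  using mem_cl_iff[OF assms, of f] cl_eq_iff[OF assms assms] assms by simp

lemma cl_eq:
  assumes "f \<in> Hom C X Y" "g \<in> cl f"
  shows "g \<in> Hom C X Y" "cl g = cl f"
  using assms mem_cl_iff cl_eq_iff by blast+

lemma cl_eq_Zero_iff:
  assumes "f \<in> Hom C X Y"
  shows "cl f = Zero Q X Y \<longleftrightarrow> f \<in> Triv C Z X Y"
proof -
  interpret comm_group "hom_group C X Y"
    using assms by (rule hom_group_at)
  have sub: "subgroup (Triv C Z X Y) (hom_group C X Y)"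
    using assms Hom_Obj Triv_subgroup by blast
  have Zero: "Zero Q X Y = Triv C Z X Y"
    by (simp add: quotient_category_def)
  have "f \<in> Triv C Z X Y" if "cl f = Zero Q X Y"
    using cl_self[OF assms] that Zero by simp
  moreover have "cl f = Zero Q X Y" if "f \<in> Triv C Z X Y"
    using coset_join2[OF _ sub that] assms Zero by (simp add: cl_eq_rcos)
  ultimately show ?thesis
    by blast
qed

lemma Obj_Q [simp]: "Obj Q = Obj C"
  by (simp add: quotient_category_def)

lemma Ident_Q [simp]: "Ident Q X = cl (Ident C X)"
  by (simp add: quotient_category_def)

lemma hom_group_Q:
  "\<lbrakk>X \<in> Obj C; Y \<in> Obj C\<rbrakk> \<Longrightarrow> hom_group Q X Y = hom_group C X Y Mod Triv C Z X Y"
  by (rule hom_group_quotient_category[OF preadditive_category_axioms Triv_subgroup])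

text \<open>Every arrow of \<open>Q\<close> has a representative in \<open>C\<close>. If
  \<open>X\<close> or \<open>Y\<close> is not an object, both sides are empty, so no side condition
  is imposed.\<close>

lemma Hom_Q: "Hom Q X Y = cl ` Hom C X Y"
proof -
  have eq: "carrier (hom_group C V W Mod Triv C Z V W) = cl ` Hom C V W" for V W
    by (force simp: FactGroup_def RCOSETS_def cl_eq_rcos)
  have obj: "Hom Q V W = cl ` Hom C V W" if "V \<in> Obj C" "W \<in> Obj C" for V W
    using hom_group_Q[OF that] eq[of V W] hom_group_sel(1)[of Q V W] by simp
  show ?thesis
  proof
    show "Hom Q X Y \<subseteq> cl ` Hom C X Y"
    proof
      fix u assume u: "u \<in> Hom Q X Y"
      then obtain V W where VW: "V \<in> Obj C" "W \<in> Obj C" "u \<in> cl ` Hom C V W"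
        by (auto simp: Hom_def quotient_category_def eq[unfolded Hom_def])
      then have "u \<in> Hom Q V W"
        using obj by simp
      then have "V = X" "W = Y"
        using u by (auto simp: Hom_def)
      with VW show "u \<in> cl ` Hom C X Y"
        by simp
    qed
    show "cl ` Hom C X Y \<subseteq> Hom Q X Y"
      using obj Hom_Obj by blast
  qed
qed

lemma cl_Hom: "f \<in> Hom C X Y \<Longrightarrow> cl f \<in> Hom Q X Y"
  by (simp add: Hom_Q)

lemma Hom_QE:
  assumes "u \<in> Hom Q X Y"
  obtains f where "f \<in> Hom C X Y" "u = cl f"
  using assms by (auto simp: Hom_Q)

text \<open>Trivial morphisms absorb composition on either side, so \<open>f'\<close> and then
  \<open>g'\<close> can be replaced, passing through \<open>g' \<cdot> f\<close>.\<close>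

lemma cl_Comp_cong:
  assumes "f \<in> Hom C X Y" "f' \<in> Hom C X Y" "g \<in> Hom C Y W" "g' \<in> Hom C Y W"
    and eq: "cl f' = cl f" "cl g' = cl g"
  shows "cl (g' \<cdot> f') = cl (g \<cdot> f)"
proof -
  have gf: "g' \<cdot> f' \<in> Hom C X W" "g' \<cdot> f \<in> Hom C X W" "g \<cdot> f \<in> Hom C X W"
    using assms Comp_Hom by blast+
  have "diff f' f \<in> Triv C Z X Y" "diff g' g \<in> Triv C Z Y W"
    using assms cl_eq_iff by blast+
  then have "diff (g' \<cdot> f') (g' \<cdot> f) \<in> Triv C Z X W" "diff (g' \<cdot> f) (g \<cdot> f) \<in> Triv C Z X W"
    using Comp_Triv[of "diff f' f" Z X Y g' W] Triv_Comp[of f X Y "diff g' g" Z W] assms(1-4)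
    by (simp_all add: Comp_diff diff_Comp)
  then show ?thesis
    using gf cl_eq_iff by metis
qed

lemma Comp_cl:
  assumes f: "f \<in> Hom C X Y" and g: "g \<in> Hom C Y W"
  shows "cl g \<cdot>\<^bsub>Q\<^esub> cl f = cl (g \<cdot> f)"
proof -
  have "cl (g' \<cdot> f') = cl (g \<cdot> f)" if "g' \<in> cl g" "f' \<in> cl f" for g' f'
    using cl_Comp_cong[OF f _ g] cl_eq[OF f that(2)] cl_eq[OF g that(1)] by blast
  \<comment> \<open>Composition in \<open>Q\<close> is a union over all pairs of representatives.
    Here the union is of a constant family, and \<open>cl_self\<close> makes its index sets
    nonempty.\<close>
  then have "(\<Union>g' \<in> cl g. \<Union>f' \<in> cl f. cl (g' \<cdot> f')) = (\<Union>g' \<in> cl g. \<Union>f' \<in> cl f. cl (g \<cdot> f))"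
    by simp
  also have "\<dots> = cl (g \<cdot> f)"
    using cl_self[OF f] cl_self[OF g] by blast
  finally show ?thesis
    by (simp add: quotient_category_def)
qed

lemma cl_hom:
  assumes "X \<in> Obj C" "Y \<in> Obj C"
  shows "cl \<in> hom (hom_group C X Y) (hom_group Q X Y)"
proof -
  have *: "(#>\<^bsub>hom_group C X Y\<^esub>) (Triv C Z X Y) \<in> hom (hom_group C X Y) (hom_group Q X Y)"
    using normal.r_coset_hom_Mod[OF Triv_normal[OF assms]] by (simp add: hom_group_Q[OF assms])
  have "cl (Add C f g) = Add Q (cl f) (cl g)" if "f \<in> Hom C X Y" "g \<in> Hom C X Y" for f g
    using hom_mult[OF *, of f g] that by (simp add: cl_eq_rcos[OF Add_Hom[OF that]] cl_eq_rcos)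
  then show ?thesis
    by (simp add: hom_def Hom_Q)
qed

lemma Add_cl:
  assumes "f \<in> Hom C X Y" "g \<in> Hom C X Y"
  shows "Add Q (cl f) (cl g) = cl (Add C f g)"
  using hom_mult[OF cl_hom, of X Y f g] Hom_Obj[OF assms(1)] assms by simp

section \<open>Category axioms and preadditive structure of the quotient\<close>

lemma category_Q: "category Q"
proof
  fix u assume "u \<in> Arr Q"
  then have "u \<in> Hom Q (Dom Q u) (Cod Q u)"
    by (simp add: Hom_def)
  then show "Dom Q u \<in> Obj Q" "Cod Q u \<in> Obj Q"
    using Hom_Obj by (auto elim!: Hom_QE)
next
  fix X assume "X \<in> Obj Q"
  then show "Ident Q X \<in> Hom Q X X"
    by (simp add: cl_Hom Ident_Hom)
next
  fix u v X Y W assume "u \<in> Hom Q X Y" "v \<in> Hom Q Y W"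
  then show "v \<cdot>\<^bsub>Q\<^esub> u \<in> Hom Q X W"
    using cl_Hom[OF Comp_Hom] by (auto elim!: Hom_QE simp: Comp_cl)
next
  fix u X Y assume "u \<in> Hom Q X Y"
  then obtain f where f: "f \<in> Hom C X Y" "u = cl f"
    by (rule Hom_QE)
  then have "X \<in> Obj C" "Y \<in> Obj C"
    using Hom_Obj by blast+
  with f show "u \<cdot>\<^bsub>Q\<^esub> Ident Q X = u" "Ident Q Y \<cdot>\<^bsub>Q\<^esub> u = u"
    using Comp_cl[OF Ident_Hom f(1)] Comp_cl[OF f(1) Ident_Hom]
    by (simp_all add: Comp_Ident Ident_Comp)
next
  fix u v w X Y V W assume "u \<in> Hom Q V X" "v \<in> Hom Q X Y" "w \<in> Hom Q Y W"
  then obtain f g h where fgh: "f \<in> Hom C V X" "g \<in> Hom C X Y" "h \<in> Hom C Y W"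
    and uvw: "u = cl f" "v = cl g" "w = cl h"
    unfolding Hom_Q by blast
  show "w \<cdot>\<^bsub>Q\<^esub> v \<cdot>\<^bsub>Q\<^esub> u = w \<cdot>\<^bsub>Q\<^esub> (v \<cdot>\<^bsub>Q\<^esub> u)"
    using fgh Comp_cl[OF fgh(1,2)] Comp_cl[OF fgh(2,3)]
      Comp_cl[OF fgh(1) Comp_Hom[OF fgh(2,3)]] Comp_cl[OF Comp_Hom[OF fgh(1,2)] fgh(3)]
    by (simp add: uvw Comp_assoc)
qed

lemma preadditive_Q: "preadditive_category Q"
proof (intro preadditive_category.intro preadditive_category_axioms.intro category_Q)
  fix X Y assume "X \<in> Obj Q" "Y \<in> Obj Q"
  then show "comm_group (hom_group Q X Y)"
    by (simp add: hom_group_Q comm_group.abelian_FactGroup hom_group Triv_subgroup)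
next
  fix u u' v X Y W assume "u \<in> Hom Q X Y" "u' \<in> Hom Q X Y" "v \<in> Hom Q Y W"
  then obtain f f' g where fg: "f \<in> Hom C X Y" "f' \<in> Hom C X Y" "g \<in> Hom C Y W"
    and uv: "u = cl f" "u' = cl f'" "v = cl g"
    unfolding Hom_Q by blast
  show "v \<cdot>\<^bsub>Q\<^esub> Add Q u u' = Add Q (v \<cdot>\<^bsub>Q\<^esub> u) (v \<cdot>\<^bsub>Q\<^esub> u')"
    using Comp_cl[OF fg(1,3)] Comp_cl[OF fg(2,3)] Comp_cl[OF Add_Hom[OF fg(1,2)] fg(3)]
      Add_cl[OF fg(1,2)] Add_cl[OF Comp_Hom[OF fg(1,3)] Comp_Hom[OF fg(2,3)]] Comp_Add[OF fg]
    by (simp add: uv)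
next
  fix u v v' X Y W assume "u \<in> Hom Q X Y" "v \<in> Hom Q Y W" "v' \<in> Hom Q Y W"
  then obtain f g g' where fg: "f \<in> Hom C X Y" "g \<in> Hom C Y W" "g' \<in> Hom C Y W"
    and uv: "u = cl f" "v = cl g" "v' = cl g'"
    unfolding Hom_Q by blast
  show "Add Q v v' \<cdot>\<^bsub>Q\<^esub> u = Add Q (v \<cdot>\<^bsub>Q\<^esub> u) (v' \<cdot>\<^bsub>Q\<^esub> u)"
    using Comp_cl[OF fg(1,2)] Comp_cl[OF fg(1,3)] Comp_cl[OF fg(1) Add_Hom[OF fg(2,3)]]
      Add_cl[OF fg(2,3)] Add_cl[OF Comp_Hom[OF fg(1,2)] Comp_Hom[OF fg(1,3)]] Add_Comp[OF fg]
    by (simp add: uv)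
qed

section \<open>Zero objects and zero morphisms of the quotient\<close>

lemma zero_object_Q:
  assumes V: "V \<in> Z"
  shows "zero_object Q V"
proof -
  have VO: "V \<in> Obj C"
    using V T_Obj by blast
  interpret Q: preadditive_category Q
    by (rule preadditive_Q)
  have "\<exists>!u. u \<in> Hom Q X V" if X: "X \<in> Obj C" for X
  proof (rule ex1I)
    show "Zero Q X V \<in> Hom Q X V"
      using Q.Zero_Hom X VO by simp
    \<comment> \<open>Every morphism of \<open>C\<close> into \<open>V\<close> factors through
      \<open>V\<close> itself, hence is trivial and has the zero class.\<close>
    show "u = Zero Q X V" if "u \<in> Hom Q X V" for u
      using that V Hom_Triv_right cl_eq_Zero_iff by (blast elim: Hom_QE)
  qed
  moreover have "\<exists>!u. u \<in> Hom Q V X" if X: "X \<in> Obj C" for X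
  proof (rule ex1I)
    show "Zero Q V X \<in> Hom Q V X"
      using Q.Zero_Hom X VO by simp
    show "u = Zero Q V X" if "u \<in> Hom Q V X" for u
      using that V Hom_Triv_left cl_eq_Zero_iff by (blast elim: Hom_QE)
  qed
  ultimately show ?thesis
    using VO by (simp add: zero_object_def)
qed

lemma pointed_Q: "pointed_category Q"
  using Z_nonempty zero_object_Q category_Q
  by (auto simp: pointed_category_def pointed_category_axioms_def)

text \<open>Translates the zero conditions in kernels and cokernels of \<open>Q\<close> into the
  triviality conditions of Z-kernels and Z-cokernels of \<open>C\<close>.\<close>

lemma zero_morphism_Q_iff:
  assumes "f \<in> Hom C X Y"
  shows "zero_morphism Q (cl f) \<longleftrightarrow> f \<in> Triv C Z X Y"
  using preadditive_category.zero_morphism_iff[OF preadditive_Q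
      pointed_category.ex_zero_object[OF pointed_Q] cl_Hom[OF assms]] cl_eq_Zero_iff[OF assms]
  by simp

section \<open>Preservation of short exact sequences\<close>

lemma is_kernel_Q:
  assumes ker: "zkernel C Z e n" "e \<in> Hom C X A" "n \<in> Hom C A B"
  shows "is_kernel Q (cl e) (cl n)"
proof -
  interpret Q: preadditive_category Q
    by (rule preadditive_Q)
  have DC: "Dom Q (cl e) = X" "Cod Q (cl e) = A" "Dom Q (cl n) = A" "cl e \<in> Arr Q" "cl n \<in> Arr Q"
    using Q.Hom_DomCod cl_Hom ker(2,3) by blast+
  have ne: "zero_morphism Q (cl n \<cdot>\<^bsub>Q\<^esub> cl e)"
    using zero_morphism_Q_iff[OF Comp_Hom[OF ker(2,3)]] Comp_cl[OF ker(2,3)] zkernel_trivial[OF ker]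
    by simp
  have "\<exists>!k. k \<in> Hom Q Y X \<and> u = cl e \<cdot>\<^bsub>Q\<^esub> k"
    if u: "u \<in> Hom Q Y A" "zero_morphism Q (cl n \<cdot>\<^bsub>Q\<^esub> u)" for u Y
  proof -
    obtain l where l: "l \<in> Hom C Y A" "u = cl l"
      using u(1) by (rule Hom_QE)
    have "n \<cdot> l \<in> Triv C Z Y B"
      using u(2) zero_morphism_Q_iff[OF Comp_Hom[OF l(1) ker(3)]] Comp_cl[OF l(1) ker(3)] l(2) by simp
    \<comment> \<open>Existence: a representative of \<open>u\<close> already lifts in
      \<open>C\<close>.\<close>
    then obtain k where k: "k \<in> Hom C Y X" "l = e \<cdot> k"
      using zkernel_lift[OF ker l(1)] by blast
    show ?thesis
    proof (rule ex1I)
      show "cl k \<in> Hom Q Y X \<and> u = cl e \<cdot>\<^bsub>Q\<^esub> cl k"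
        using k l(2) cl_Hom Comp_cl ker(2) by simp
    next
      fix w assume w: "w \<in> Hom Q Y X \<and> u = cl e \<cdot>\<^bsub>Q\<^esub> w"
      then obtain k' where k': "k' \<in> Hom C Y X" "w = cl k'"
        by (blast elim: Hom_QE)
      \<comment> \<open>Uniqueness: two representatives need only agree after \<open>e\<close>
        modulo trivial morphisms, so uniqueness in \<open>C\<close> does not apply directly. Their
        difference is trivial because \<open>e\<close> reflects triviality.\<close>
      have "cl (e \<cdot> k') = cl (e \<cdot> k)"
        using w k' k(2) l(2) Comp_cl[OF k'(1) ker(2)] by simp
      then have "diff (e \<cdot> k') (e \<cdot> k) \<in> Triv C Z Y A"
        using cl_eq_iff Comp_Hom k(1) k'(1) ker(2) by blast
      then have "e \<cdot> diff k' k \<in> Triv C Z Y A"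
        using Comp_diff[OF k'(1) k(1) ker(2)] by simp
      then have "diff k' k \<in> Triv C Z Y X"
        using zkernel_reflects_Triv[OF ker diff_Hom[OF k'(1) k(1)]] by blast
      then show "w = cl k"
        using cl_eq_iff k(1) k' by blast
    qed
  qed
  then show ?thesis
    unfolding is_kernel_def DC using ne DC Q.Arr_Hom by metis
qed

lemma is_cokernel_Q:
  assumes coker: "zcokernel C Z n e" "e \<in> Hom C X A" "n \<in> Hom C A B"
  shows "is_cokernel Q (cl n) (cl e)"
proof -
  interpret Q: preadditive_category Q
    by (rule preadditive_Q)
  have DC: "Cod Q (cl e) = A" "Dom Q (cl n) = A" "Cod Q (cl n) = B" "cl e \<in> Arr Q" "cl n \<in> Arr Q"
    using Q.Hom_DomCod cl_Hom coker(2,3) by blast+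
  have "n \<cdot> e \<in> Triv C Z X B"
    using coker(1) ztrivial_iff[OF Comp_Hom[OF coker(2,3)]] by (simp add: zcokernel_def)
  then have ne: "zero_morphism Q (cl n \<cdot>\<^bsub>Q\<^esub> cl e)"
    using zero_morphism_Q_iff[OF Comp_Hom[OF coker(2,3)]] Comp_cl[OF coker(2,3)] by simp
  have "\<exists>!k. k \<in> Hom Q B Y \<and> u = k \<cdot>\<^bsub>Q\<^esub> cl n"
    if u: "u \<in> Hom Q A Y" "zero_morphism Q (u \<cdot>\<^bsub>Q\<^esub> cl e)" for u Y
  proof -
    obtain l where l: "l \<in> Hom C A Y" "u = cl l"
      using u(1) by (rule Hom_QE)
    have "l \<cdot> e \<in> Triv C Z X Y"
      using u(2) zero_morphism_Q_iff[OF Comp_Hom[OF coker(2) l(1)]] Comp_cl[OF coker(2) l(1)] l(2)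
      by simp
    then obtain k where k: "k \<in> Hom C B Y" "l = k \<cdot> n"
      using zcokernel_extend[OF coker l(1)] by blast
    show ?thesis
    proof (rule ex1I)
      show "cl k \<in> Hom Q B Y \<and> u = cl k \<cdot>\<^bsub>Q\<^esub> cl n"
        using k l(2) cl_Hom Comp_cl coker(3) by simp
    next
      fix w assume w: "w \<in> Hom Q B Y \<and> u = w \<cdot>\<^bsub>Q\<^esub> cl n"
      then obtain k' where k': "k' \<in> Hom C B Y" "w = cl k'"
        by (blast elim: Hom_QE)
      \<comment> \<open>Dually to kernels, uniqueness rests on \<open>n\<close> reflecting
        triviality.\<close>
      have "cl (k' \<cdot> n) = cl (k \<cdot> n)"
        using w k' k(2) l(2) Comp_cl[OF coker(3) k'(1)] by simp
      then have "diff (k' \<cdot> n) (k \<cdot> n) \<in> Triv C Z A Y"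
        using cl_eq_iff Comp_Hom k(1) k'(1) coker(3) by blast
      then have "diff k' k \<cdot> n \<in> Triv C Z A Y"
        using diff_Comp[OF coker(3) k'(1) k(1)] by simp
      then have "diff k' k \<in> Triv C Z B Y"
        using zcokernel_reflects_Triv[OF coker diff_Hom[OF k'(1) k(1)]] by blast
      then show "w = cl k"
        using cl_eq_iff k(1) k' by blast
    qed
  qed
  then show ?thesis
    unfolding is_cokernel_def DC using ne DC Q.Arr_Hom by metis
qed

lemma short_exact_Q:
  assumes "short_zexact C Z e n" "e \<in> Hom C X A" "n \<in> Hom C A B"
  shows "short_exact Q (cl e) (cl n)"
  using assms is_kernel_Q is_cokernel_Q by (simp add: short_zexact_def short_exact_def)

section \<open>The induced torsion theory\<close>

lemma isomorphic_QE:
  assumes "isomorphic_objects Q X Y"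
  obtains f g where "f \<in> Hom C X Y" "g \<in> Hom C Y X" "diff (Ident C Y) (f \<cdot> g) \<in> Triv C Z Y Y"
proof -
  \<comment> \<open>Only the identity on \<open>Y\<close> is kept: it exhibits \<open>Y\<close> as a
    retract of \<open>X\<close> modulo trivial morphisms.\<close>
  obtain f g where f: "f \<in> Hom C X Y" and g: "g \<in> Hom C Y X" and "cl f \<cdot>\<^bsub>Q\<^esub> cl g = cl (Ident C Y)"
    using assms unfolding isomorphic_objects_def Hom_Q Ident_Q by blast
  then have "cl (Ident C Y) = cl (f \<cdot> g)"
    using Comp_cl by simp
  moreover have "Ident C Y \<in> Hom C Y Y"
    using f Hom_Obj Ident_Hom by blast
  ultimately have "diff (Ident C Y) (f \<cdot> g) \<in> Triv C Z Y Y"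
    using cl_eq_iff Comp_Hom f g by blast
  with f g that show ?thesis
    by blast
qed

text \<open>Isomorphism in \<open>Q\<close> is a retraction condition modulo trivial morphisms, so
  closure of \<open>T\<close> and \<open>F\<close> under it comes from the retract lemmas.
  Orthogonality and exact sequences are carried over from \<open>C\<close> by
  \<open>cl\<close>.\<close>

lemma torsion_theory_Q: "torsion_theory Q T F"
proof -
  have "Y \<in> T" if "X \<in> T" "isomorphic_objects Q X Y" for X Y
    using that(2) T_retract_mod_Triv[OF that(1)] by (rule isomorphic_QE)
  moreover have "Y \<in> F" if "X \<in> F" "isomorphic_objects Q X Y" for X Y
    using that(2) F_retract_mod_Triv[OF that(1)] by (rule isomorphic_QE)
  moreover have "T \<subseteq> Obj C" "F \<subseteq> Obj C"
    using pretorsion by (simp_all add: pretorsion_theory_def replete_full_subcategory_def)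
  ultimately have "replete_full_subcategory Q T" "replete_full_subcategory Q F"
    unfolding replete_full_subcategory_def Obj_Q by blast+
  moreover have "zero_morphism Q u" if X: "X \<in> T" and Y: "Y \<in> F" and u: "u \<in> Hom Q X Y" for X Y u
  proof -
    obtain f where "f \<in> Hom C X Y" "u = cl f"
      using u by (rule Hom_QE)
    then show ?thesis
      using T_F_Triv X Y zero_morphism_Q_iff by blast
  qed
  moreover have "\<exists>TX \<in> T. \<exists>FX \<in> F. \<exists>f \<in> Hom Q TX X. \<exists>g \<in> Hom Q X FX. short_exact Q f g"
    if X: "X \<in> Obj C" for X
  proof -
    obtain TX FX e n where "TX \<in> T" "FX \<in> F" "e \<in> Hom C TX X" "n \<in> Hom C X FX"
      "zkernel C Z e n" "zcokernel C Z n e"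
      using X by (rule canonical_sequence)
    then show ?thesis
      using short_exact_Q cl_Hom unfolding short_zexact_def by blast
  qed
  ultimately show ?thesis
    using pointed_Q by (simp add: torsion_theory_def)
qed

section \<open>The quotient functor and its universal property\<close>

abbreviation "S \<equiv> quotient_functor C Z"

lemma S_sel [simp]: "on_obj S X = X" "on_arr S = cl"
  by (simp_all add: quotient_functor_def)

lemma is_functor_S: "is_functor C Q S"
  by (intro is_functor.intro is_functor_axioms.intro category_axioms category_Q)
    (simp_all add: cl_Hom Comp_cl)

lemma additive_functor_S: "additive_functor C Q S"
  using preadditive_category_axioms preadditive_Q is_functor_S cl_hom
  by (simp add: additive_functor_def)

lemma torsion_theory_functor_S: "torsion_theory_functor C T F Q T F S"
  using pretorsion torsion_theory_Q is_functor_S short_exact_Q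
  by (auto simp: torsion_theory_functor_def)

lemma quotient_functor_universal:
  assumes add: "additive_functor C D G"
    and point: "pointed_category D"
    and zero: "\<And>f. \<lbrakk>f \<in> Arr C; ztrivial C Z f\<rbrakk> \<Longrightarrow> zero_morphism D (on_arr G f)"
  shows "\<exists>H. is_functor Q D H \<and> functor_eq C G (functor_comp H S) \<and>
    (\<forall>H'. is_functor Q D H' \<and> functor_eq C G (functor_comp H' S) \<longrightarrow> functor_eq Q H' H)"
proof -
  interpret D: preadditive_category D
    using add by (simp add: additive_functor_def)
  interpret G: is_functor C D G
    using add by (simp add: additive_functor_def)
  \<comment> \<open>\<open>G\<close> is constant on cosets: by additivity
    \<open>G f' = G (f' - f) + G f\<close>, and the first summand vanishes because
    \<open>f' - f\<close> is trivial.\<close>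
  have const: "on_arr G f' = on_arr G f" if f: "f \<in> Hom C X Y" and f': "f' \<in> cl f" for f f' X Y
  proof -
    interpret H: comm_group "hom_group D (on_obj G X) (on_obj G Y)"
      using f G.on_arr_Hom D.hom_group_at by blast
    have f'H: "f' \<in> Hom C X Y" and d: "diff f' f \<in> Triv C Z X Y"
      using mem_cl_iff[OF f] f' by blast+
    have dH: "diff f' f \<in> Hom C X Y"
      using d by (rule Triv_Hom)
    have "zero_morphism D (on_arr G (diff f' f))"
      using zero d dH Hom_DomCod ztrivial_iff by blast
    then have "on_arr G (diff f' f) = Zero D (on_obj G X) (on_obj G Y)"
      using D.zero_morphism_iff[OF pointed_category.ex_zero_object[OF point] G.on_arr_Hom[OF dH]]
      by simp
    moreover have "on_arr G \<in> hom (hom_group C X Y) (hom_group D (on_obj G X) (on_obj G Y))"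
      using add Hom_Obj[OF f] by (simp add: additive_functor_def)
    then have "on_arr G (Add C (diff f' f) f) = Add D (on_arr G (diff f' f)) (on_arr G f)"
      using hom_mult dH f by fastforce
    ultimately show ?thesis
      using diff_Add_cancel[OF f'H f] H.l_one[of "on_arr G f"] G.on_arr_Hom[OF f] by simp
  qed
  \<comment> \<open>\<open>G\<close> is applied to an arbitrary representative; \<open>const\<close>
    makes the choice irrelevant.\<close>
  define H where "H = \<lparr>on_obj = on_obj G, on_arr = \<lambda>u. on_arr G (SOME f. f \<in> u)\<rparr>"
  have H_obj: "on_obj H = on_obj G"
    by (simp add: H_def)
  have H_cl: "on_arr H (cl f) = on_arr G f" if f: "f \<in> Hom C X Y" for f X Y
    using const[OF f someI[of "\<lambda>f'. f' \<in> cl f", OF cl_self[OF f]]] by (simp add: H_def)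
  have "is_functor Q D H"
  proof (intro is_functor.intro is_functor_axioms.intro category_Q D.category_axioms)
    fix X assume "X \<in> Obj Q"
    then show "on_obj H X \<in> Obj D" "on_arr H (Ident Q X) = Ident D (on_obj H X)"
      using H_cl[OF Ident_Hom] by (simp_all add: H_obj G.on_obj_Obj G.on_arr_Ident)
  next
    fix u X Y assume "u \<in> Hom Q X Y"
    then show "on_arr H u \<in> Hom D (on_obj H X) (on_obj H Y)"
      by (auto elim!: Hom_QE simp: H_obj H_cl G.on_arr_Hom)
  next
    fix u v X Y W assume "u \<in> Hom Q X Y" "v \<in> Hom Q Y W"
    then obtain f g where f: "f \<in> Hom C X Y" "u = cl f" and g: "g \<in> Hom C Y W" "v = cl g"
      unfolding Hom_Q by blast
    then show "on_arr H (v \<cdot>\<^bsub>Q\<^esub> u) = on_arr H v \<cdot>\<^bsub>D\<^esub> on_arr H u"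
      using H_cl[OF Comp_Hom[OF f(1) g(1)]] H_cl[OF f(1)] H_cl[OF g(1)]
      by (simp add: Comp_cl G.on_arr_Comp)
  qed
  moreover have "functor_eq C G (functor_comp H S)"
    using H_cl[OF Arr_Hom] by (simp add: functor_eq_def functor_comp_def H_obj)
  \<comment> \<open>Uniqueness holds because \<open>S\<close> is the identity on objects and every
    arrow of \<open>Q\<close> is some \<open>cl f\<close>, where the value of \<open>H'\<close> is
    forced to be \<open>G f\<close>.\<close>
  moreover have "functor_eq Q H' H" if "functor_eq C G (functor_comp H' S)" for H'
  proof -
    have "on_arr H' u = on_arr H u" if "u \<in> Arr Q" for u
    proof -
      have "u \<in> Hom Q (Dom Q u) (Cod Q u)"
        using that by (simp add: Hom_def)
      then obtain f where f: "f \<in> Hom C (Dom Q u) (Cod Q u)" "u = cl f"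
        by (rule Hom_QE)
      then show ?thesis
        using \<open>functor_eq C G (functor_comp H' S)\<close> H_cl[OF f(1)] Hom_DomCod
        by (simp add: functor_eq_def functor_comp_def)
    qed
    then show ?thesis
      using that by (simp add: functor_eq_def functor_comp_def H_obj)
  qed
  ultimately show ?thesis
    by blast
qed

end

theorem theorem4p3:
  fixes C :: "('o, 'm) addcat" and T F :: "'o set"
  assumes "additive_category C"
    and "pretorsion_theory C T F"
  shows
    "let Z = T \<inter> F; Q = quotient_category C Z; S = quotient_functor C Z in
       ((\<forall>X \<in> Z. zero_object Q (on_obj S X)) \<and>
        (\<forall>f \<in> Arr C. ztrivial C Z f \<longrightarrow> zero_morphism Q (on_arr S f))) \<and>
       (additive_functor C Q S \<and>
        torsion_theory_functor C T F Q (on_obj S ` T) (on_obj S ` F) S) \<and>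
       torsion_theory Q (on_obj S ` T) (on_obj S ` F) \<and>
       (\<forall>(D :: ('p, 'q) addcat) G.
          pointed_category D \<and> preadditive_category D \<and> is_functor C D G \<and>
          ((\<forall>X \<in> Z. zero_object D (on_obj G X)) \<and>
           (\<forall>f \<in> Arr C. ztrivial C Z f \<longrightarrow> zero_morphism D (on_arr G f))) \<and>
          (additive_functor C D G \<and>
           torsion_theory_functor C T F D (on_obj G ` T) (on_obj G ` F) G) \<and>
          torsion_theory D (on_obj G ` T) (on_obj G ` F) \<longrightarrow>
          (\<exists>H. is_functor Q D H \<and> functor_eq C G (functor_comp H S) \<and>
            (\<forall>H'. is_functor Q D H' \<and> functor_eq C G (functor_comp H' S) \<longrightarrow>
              functor_eq Q H' H)))"
proof -
  interpret additive_pretorsion C T F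
    using assms by (simp add: additive_pretorsion_def additive_pretorsion_axioms_def)
  have trivial: "zero_morphism Q (cl f)" if "f \<in> Arr C" "ztrivial C Z f" for f
    using that zero_morphism_Q_iff[OF Arr_Hom] ztrivial_iff[OF Arr_Hom] by blast
  \<comment> \<open>As \<open>S\<close> fixes objects, the image subcategories are given by the same
    object sets \<open>T\<close> and \<open>F\<close>, to which the lemmas above apply.\<close>
  have image: "on_obj S ` T = T" "on_obj S ` F = F"
    by simp_all
  show ?thesis
    unfolding Let_def image S_sel
    using zero_object_Q trivial additive_functor_S torsion_theory_functor_S torsion_theory_Q
      quotient_functor_universal
    by (intro conjI allI impI ballI) blast+
qed

end
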